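(* For the private gossip algorithm with binary oracle, with stepsizes chosen in iteration $t$ adaptively to the current values of $x^t$ as $\lambda^t=\frac1{2m}\sum_{e=(i,j)\in\mathcal E}|x^t_i-x^t_j|$, one has for all $k\ge0$ $$\mathbb{E}\left[\|\bar c\,\mathbf 1-x^k\|^2\right]\le\left(1-\frac{\alpha(\mathcal G)}{2m^2}\right)^k\|\bar c\,\mathbf 1-x^0\|^2 .$$
   Context: $\mathcal G=(\mathcal V,\mathcal E)$ is an undirected connected (simple) graph with $\mathcal V=\{1,\dots,n\}$, $n\ge2$, $|\mathcal E|=m$. Each edge is written $e=(i,j)$ with a fixed orientation. $\alpha(\mathcal G)$ (algebraic connectivity) is the second smallest eigenvalue of the graph Laplacian. $c\in\mathbb{R}^n$ is the vector of initial values, $\bar c=\frac1n\sum_ic_i$, $\mathbf 1\in\mathbb{R}^n$ is the all-ones vector, and $\|\cdot\|$ is the Euclidean norm. Private gossip with binary oracle: set $x^0=c$. In each iteration $t=0,1,\dots$ choose $e=(i,j)\in\mathcal E$ uniformly at random, independently of the past. If $x^t_i<x^t_j$ set $x^{t+1}_i=x^t_i+\lambda^t$, $x^{t+1}_j=x^t_j-\lambda^t$; if $x^t_i\ge x^t_j$ set $x^{t+1}_i=x^t_i-\lambda^t$, $x^{t+1}_j=x^t_j+\lambda^t$; and $x^{t+1}_l=x^t_l$ for $l\notin\{i,j\}$. Here $\lambda^t$ is the stepsize of iteration $t$. *)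

theory Defs
  imports "HOL-Probability.Probability" "HOL-Computational_Algebra.Polynomial"
begin

text \<open>
  The vertex set is the finite index type \<open>'n\<close>, so that \<open>n = CARD('n)\<close> and
  vectors of vertex values live in \<open>real ^ 'n\<close>. A simple undirected graph whose edges carry a
  fixed orientation is an asymmetric relation \<open>E\<close>: asymmetry excludes loops and ensures that
  every undirected edge is listed in exactly one direction, hence \<open>m = card E\<close>.
\<close>

definition connected_simple_graph :: "('n \<times> 'n) set \<Rightarrow> bool" where
  "connected_simple_graph E \<longleftrightarrow> asym E \<and> (\<forall>u v. (u, v) \<in> (E \<union> E\<inverse>)\<^sup>*)"

definition neighbours :: "('n \<times> 'n) set \<Rightarrow> 'n \<Rightarrow> 'n set" where
  "neighbours E i = {j. (i, j) \<in> E \<union> E\<inverse>}"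

definition laplacian :: "('n::finite \<times> 'n) set \<Rightarrow> real ^ 'n ^ 'n" where
  "laplacian E = (\<chi> i j. if i = j then real (card (neighbours E i))
                        else if j \<in> neighbours E i then - 1 else 0)"

definition charpoly :: "real ^ 'n ^ 'n \<Rightarrow> real poly" where
  "charpoly A = det (mat [:0, 1:] - map_matrix (\<lambda>a. [:a:]) A)"

lemma poly_charpoly: "poly (charpoly A) \<mu> = det (mat \<mu> - A)"
  unfolding charpoly_def det_def
  by (simp add: poly_sum poly_prod mat_def map_matrix_def if_distrib[of "\<lambda>p. poly p \<mu>"] cong: if_cong)

lemma charpoly_root_iff_eigenvalue:
  fixes A :: "real ^ 'n ^ 'n"
  shows "poly (charpoly A) \<mu> = 0 \<longleftrightarrow> (\<exists>v. v \<noteq> 0 \<and> A *v v = \<mu> *s v)"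
proof -
  have "mat \<mu> *v v = \<mu> *s v" for v :: "real ^ 'n"
    by (simp add: vec_eq_iff matrix_vector_mult_def mat_def if_distrib if_distribR cong: if_cong)
  then have "(mat \<mu> - A) *v v = \<mu> *s v - A *v v" for v
    by (simp add: matrix_vector_mult_diff_rdistrib)
  then show ?thesis
    using invertible_det_nz[of "mat \<mu> - A"] invertible_left_inverse[of "mat \<mu> - A"]
      matrix_left_invertible_ker[of "mat \<mu> - A"]
    by (auto simp: poly_charpoly)
qed

text \<open>
  All real eigenvalues in increasing order, each repeated according to its multiplicity as a root
  of the characteristic polynomial. For a symmetric matrix these are all \<open>CARD('n)\<close> eigenvalues.
\<close>

definition eigenvalues :: "real ^ 'n ^ 'n \<Rightarrow> real list" where
  "eigenvalues A = sorted_list_of_multiset (proots (charpoly A))"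

definition algebraic_connectivity :: "('n::finite \<times> 'n) set \<Rightarrow> real" where
  "algebraic_connectivity E = eigenvalues (laplacian E) ! 1"

definition mean :: "real ^ 'n \<Rightarrow> real" where
  "mean c = (\<Sum>i\<in>UNIV. c $ i) / real CARD('n)"

definition gossip_step :: "real \<Rightarrow> 'n \<times> 'n \<Rightarrow> real ^ 'n \<Rightarrow> real ^ 'n" where
  "gossip_step s e x = (case e of (i, j) \<Rightarrow>
     (\<chi> l. if l = i then (if x $ i < x $ j then x $ i + s else x $ i - s)
          else if l = j then (if x $ i < x $ j then x $ j - s else x $ j + s)
          else x $ l))"

text \<open>
  The iterates for a given sequence \<open>es\<close> of chosen edges; the step size used in iteration \<open>t\<close>
  is \<open>step t\<close> evaluated at the current iterate.
\<close>

primrec private_gossip ::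
  "(nat \<Rightarrow> real ^ 'n \<Rightarrow> real) \<Rightarrow> real ^ 'n \<Rightarrow> (nat \<Rightarrow> 'n \<times> 'n) \<Rightarrow> nat \<Rightarrow> real ^ 'n" where
  "private_gossip step c es 0 = c"
| "private_gossip step c es (Suc t) =
     gossip_step (step t (private_gossip step c es t)) (es t) (private_gossip step c es t)"

definition adaptive_stepsize :: "('n \<times> 'n) set \<Rightarrow> real ^ 'n \<Rightarrow> real" where
  "adaptive_stepsize E x = 1 / (2 * real (card E)) * (\<Sum>(i, j)\<in>E. \<bar>x $ i - x $ j\<bar>)"

text \<open>A sequence of independent random edges on \<open>M\<close>, each uniformly distributed on \<open>E\<close>.\<close>

definition iid_uniform_edges ::
  "'a measure \<Rightarrow> ('n \<times> 'n) set \<Rightarrow> (nat \<Rightarrow> 'a \<Rightarrow> 'n \<times> 'n) \<Rightarrow> bool" where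
  "iid_uniform_edges M E \<xi> \<longleftrightarrow>
     prob_space.indep_vars M (\<lambda>_. count_space UNIV) \<xi> UNIV \<and>
     (\<forall>t. distr M (count_space UNIV) (\<xi> t) = measure_pmf (pmf_of_set E))"

end

theory Submission
  imports Defs
begin

text \<open>
  Moving the values at the endpoints of an edge \<open>(i, j)\<close> by \<open>s\<close> towards each other, or in opposite
  directions in a tie, keeps the mean and changes the squared distance to the mean vector by \<open>2 * s\<^sup>2 - 2 * s * \<bar>x $ i - x $ j\<bar>\<close>
  (\<open>norm_diff_const_gossip_step\<close>). Averaged over a uniformly random edge this is a quadratic
  polynomial in \<open>s\<close>, and the adaptive step size is exactly its minimiser, where it takes the value
  \<open>- S\<^sup>2 / (2 * m\<^sup>2)\<close> with \<open>S\<close> the sum of the \<open>\<bar>x $ i - x $ j\<bar>\<close> over the \<open>m\<close> edges. Since \<open>S\<^sup>2\<close>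
  is at least the sum of the \<open>(x $ i - x $ j)\<^sup>2\<close>, which is the Laplacian form of \<open>x\<close> minus its mean,
  one step contracts the squared distance on average by the factor \<open>gossip_rate E\<close>
  (\<open>average_gossip_step_le\<close>).

  The analytic input is that the Laplacian form of a mean-zero vector \<open>y\<close> is at least
  \<open>algebraic_connectivity E * (norm y)\<^sup>2\<close> (\<open>algebraic_connectivity_le_dirichlet\<close>). Minimising the
  form over mean-zero unit vectors yields a nonzero eigenvalue, and the second smallest eigenvalue
  cannot exceed it because \<open>0\<close> is an eigenvalue too.

  The iterate at time \<open>t\<close> is a function of the first \<open>t\<close> edges, and the next edge is independent of
  them (\<open>expectation_fresh_edge\<close>), so the one-step bound can be integrated and iterated; multiplying
  by the rate is legitimate because it is nonnegative (\<open>gossip_rate_nonneg\<close>). The contraction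
  refers to the mean of the current iterate, which agrees with the initial mean almost surely.
\<close>


section \<open>The Laplacian as a quadratic form\<close>

text \<open>
  Row \<open>i\<close> of \<open>laplacian E *v v\<close> is the sum of \<open>v $ i - v $ j\<close> over the neighbours \<open>j\<close> of \<open>i\<close>, and
  the two orientations of an edge contribute \<open>u $ i * (v $ i - v $ j)\<close> and
  \<open>u $ j * (v $ j - v $ i)\<close>. Self-adjointness, positive semidefiniteness and the fact that the
  image is orthogonal to the constants can all be read off from this bilinear form.
\<close>

lemma inner_laplacian:
  assumes "asym E"
  shows "u \<bullet> (laplacian E *v v) = (\<Sum>(i, j)\<in>E. (u $ i - u $ j) * (v $ i - v $ j))"
proof -
  have irr: "i \<notin> neighbours E i" for i
    using assms by (auto simp: neighbours_def dest: asymD)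
  have row: "(laplacian E *v v) $ i = (\<Sum>j\<in>neighbours E i. v $ i - v $ j)" for i
  proof -
    have "(laplacian E *v v) $ i =
        (\<Sum>j\<in>UNIV. (if j = i then real (card (neighbours E i)) * v $ i else 0)
          - (if j \<in> neighbours E i then v $ j else 0))"
      unfolding matrix_vector_mult_def laplacian_def using irr
      by (auto intro!: sum.cong)
    also have "\<dots> = (\<Sum>j\<in>neighbours E i. v $ i - v $ j)"
      by (simp add: sum_subtractf sum.delta sum.If_cases)
    finally show ?thesis .
  qed
  have disj: "E \<inter> E\<inverse> = {}"
    using assms by (auto dest: asymD)
  have "u \<bullet> (laplacian E *v v) = (\<Sum>i\<in>UNIV. \<Sum>j\<in>neighbours E i. u $ i * (v $ i - v $ j))"
    by (simp add: inner_vec_def row sum_distrib_left)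
  also have "\<dots> = (\<Sum>(i, j)\<in>(SIGMA i:UNIV. neighbours E i). u $ i * (v $ i - v $ j))"
    by (subst sum.Sigma) auto
  also have "(SIGMA i:UNIV. neighbours E i) = E \<union> E\<inverse>"
    by (auto simp: neighbours_def)
  also have "(\<Sum>(i, j)\<in>E \<union> E\<inverse>. u $ i * (v $ i - v $ j)) =
      (\<Sum>(i, j)\<in>E. u $ i * (v $ i - v $ j)) + (\<Sum>(i, j)\<in>E\<inverse>. u $ i * (v $ i - v $ j))"
    using disj by (intro sum.union_disjoint) auto
  also have "(\<Sum>(i, j)\<in>E\<inverse>. u $ i * (v $ i - v $ j)) = (\<Sum>(i, j)\<in>E. u $ j * (v $ j - v $ i))"
    by (rule sum.reindex_bij_witness[of _ prod.swap prod.swap]) auto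
  finally show ?thesis
    by (simp add: sum.distrib[symmetric] case_prod_unfold algebra_simps)
qed

lemma connected_graph_zero_differences_const:
  assumes "connected_simple_graph E" and "\<And>i j. (i, j) \<in> E \<Longrightarrow> v $ i = v $ j"
  shows "v $ i = v $ j"
proof -
  have "(i, j) \<in> (E \<union> E\<inverse>)\<^sup>*"
    using assms(1) by (auto simp: connected_simple_graph_def)
  then show ?thesis
    by (induction rule: rtrancl_induct) (use assms(2) in auto)
qed

section \<open>The spectral gap bounds the form on mean-zero vectors\<close>

text \<open>
  The part of the spectral theorem that is needed, by the variational argument: let \<open>v\<close> minimise
  \<open>x \<bullet> f x\<close> on the unit sphere of \<open>W\<close>, with minimum \<open>\<mu>\<close>. Then \<open>x \<bullet> f x - \<mu> * (x \<bullet> x)\<close> is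
  nonnegative on \<open>W\<close> and vanishes at \<open>v\<close>, so its first variation at \<open>v\<close> vanishes in every
  direction of \<open>W\<close>. Invariance of \<open>W\<close> makes the residual \<open>f v - \<mu> *\<^sub>R v\<close> itself such a direction,
  and the variation along it is twice its squared norm.
\<close>

lemma self_adjoint_min_eigenvector:
  fixes f :: "'a::euclidean_space \<Rightarrow> 'a"
  assumes f: "linear f" and adj: "\<And>x y. x \<bullet> f y = y \<bullet> f x"
    and W: "subspace W" "f ` W \<subseteq> W" "\<not> W \<subseteq> {0}"
  obtains \<mu> v where "v \<in> W" "v \<noteq> 0" "f v = \<mu> *\<^sub>R v"
    "\<And>w. w \<in> W \<Longrightarrow> \<mu> * (norm w)\<^sup>2 \<le> w \<bullet> f w"
proof -
  let ?S = "W \<inter> sphere 0 1"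
  obtain w0 where w0: "w0 \<in> W" "w0 \<noteq> 0"
    using W(3) by auto
  have "(1 / norm w0) *\<^sub>R w0 \<in> ?S"
    using w0 W(1) by (auto simp: subspace_scale)
  moreover have "compact ?S"
    using W(1) by (simp add: closed_Int_compact closed_subspace)
  moreover have "continuous_on ?S (\<lambda>x. x \<bullet> f x)"
    using f by (intro continuous_on_inner continuous_on_id linear_continuous_on)
      (simp add: linear_conv_bounded_linear)
  ultimately obtain v where v: "v \<in> ?S" and min: "\<And>w. w \<in> ?S \<Longrightarrow> v \<bullet> f v \<le> w \<bullet> f w"
    using continuous_attains_inf[of ?S "\<lambda>x. x \<bullet> f x"] by blast
  define \<mu> where "\<mu> = v \<bullet> f v"
  have vv: "v \<bullet> v = 1"
    using v by (simp add: dot_square_norm)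
  have rayleigh: "\<mu> * (norm w)\<^sup>2 \<le> w \<bullet> f w" if "w \<in> W" for w
  proof (cases "w = 0")
    case False
    have "(1 / norm w) *\<^sub>R w \<in> ?S"
      using that False W(1) by (auto simp: subspace_scale)
    from min[OF this] have "\<mu> \<le> (w \<bullet> f w) / (norm w)\<^sup>2"
      by (simp add: \<mu>_def linear_scale[OF f] power2_eq_square)
    then show ?thesis
      using False by (simp add: pos_le_divide_eq)
  qed (simp add: linear_0[OF f])
  define w where "w = f v - \<mu> *\<^sub>R v"
  have wW: "w \<in> W"
    using v W by (auto simp: w_def intro!: subspace_diff subspace_scale)
  define q where "q = w \<bullet> f w - \<mu> * (w \<bullet> w)"
  have variation: "0 \<le> 2 * t * (w \<bullet> w) + t\<^sup>2 * q" for t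
  proof -
    have "v + t *\<^sub>R w \<in> W"
      using v wW W(1) by (auto intro!: subspace_add subspace_scale)
    from rayleigh[OF this]
    have "0 \<le> (v + t *\<^sub>R w) \<bullet> f (v + t *\<^sub>R w) - \<mu> * ((v + t *\<^sub>R w) \<bullet> (v + t *\<^sub>R w))"
      by (simp add: dot_square_norm)
    also have "\<dots> = 2 * t * (w \<bullet> (f v - \<mu> *\<^sub>R v)) + t\<^sup>2 * q"
      using vv adj[of v w]
      by (simp add: linear_add[OF f] linear_scale[OF f] q_def \<mu>_def inner_commute
          algebra_simps power2_eq_square)
    finally show ?thesis
      by (simp add: w_def)
  qed
  have "w \<bullet> w = 0"
  proof (rule ccontr)
    assume "w \<bullet> w \<noteq> 0"
    then have pos: "w \<bullet> w > 0"
      by simp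
    show False
    proof (cases "q > 0")
      case True
      \<comment> \<open>the minimiser of the quadratic polynomial in \<open>t\<close>\<close>
      have "2 * (- (w \<bullet> w) / q) * (w \<bullet> w) + (- (w \<bullet> w) / q)\<^sup>2 * q = - (w \<bullet> w)\<^sup>2 / q"
        using True by (simp add: field_simps power2_eq_square)
      moreover have "- (w \<bullet> w)\<^sup>2 / q < 0"
        using True pos by (simp add: field_simps)
      ultimately show False
        using variation[of "- (w \<bullet> w) / q"] by linarith
    next
      case False
      then show False
        using variation[of "-1"] pos by simp
    qed
  qed
  then have "f v = \<mu> *\<^sub>R v"
    by (simp add: w_def)
  moreover have "v \<in> W" "v \<noteq> 0"
    using v by auto
  ultimately show thesis
    using that rayleigh by blast
qed

lemma second_le_if_less_mem:
  fixes xs :: "'a::linorder list"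
  assumes "sorted xs" "a \<in> set xs" "b \<in> set xs" "a < b"
  shows "xs ! 1 \<le> b"
proof -
  obtain p q where pq: "p < length xs" "xs ! p = a" "q < length xs" "xs ! q = b"
    using assms(2,3) by (auto simp: in_set_conv_nth)
  have "q \<noteq> 0"
  proof
    assume "q = 0"
    then have "b \<le> a"
      using sorted_nth_mono[OF assms(1), of 0 p] pq by simp
    with assms(4) show False
      by simp
  qed
  then show ?thesis
    using sorted_nth_mono[OF assms(1), of 1 q] pq by simp
qed

text \<open>
  The minimal eigenvalue \<open>\<mu>\<close> of the Laplacian on the orthogonal complement of the constants bounds
  the form from below. By connectedness \<open>\<mu> > 0\<close>, so \<open>0\<close> (with eigenvector \<open>1\<close>) and \<open>\<mu>\<close> are two
  different entries of the sorted list of eigenvalues, whose second entry is therefore at most \<open>\<mu>\<close>.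
  In this way algebraic and geometric multiplicities need not be compared.
\<close>

lemma algebraic_connectivity_le_dirichlet:
  fixes E :: "('n::finite \<times> 'n) set" and y :: "real ^ 'n"
  assumes conn: "connected_simple_graph E" and y0: "(\<Sum>i\<in>UNIV. y $ i) = 0"
  shows "algebraic_connectivity E * (norm y)\<^sup>2 \<le> (\<Sum>(i, j)\<in>E. (y $ i - y $ j)\<^sup>2)"
proof (cases "y = 0")
  case False
  let ?L = "laplacian E"
  have asym: "asym E"
    using conn by (simp add: connected_simple_graph_def)
  note form = inner_laplacian[OF asym]
  define W :: "(real ^ 'n) set" where "W = {x. 1 \<bullet> x = 0}"
  have sum_W: "x \<in> W \<longleftrightarrow> (\<Sum>i\<in>UNIV. x $ i) = 0" for x
    by (simp add: W_def inner_vec_def)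
  obtain \<mu> v where v: "v \<in> W" "v \<noteq> 0" "?L *v v = \<mu> *\<^sub>R v"
    and rayleigh: "\<And>w. w \<in> W \<Longrightarrow> \<mu> * (norm w)\<^sup>2 \<le> w \<bullet> (?L *v w)"
  proof (rule self_adjoint_min_eigenvector[of "(*v) ?L" W])
    show "linear ((*v) ?L)"
      by (rule matrix_vector_mul_linear)
    show "x \<bullet> (?L *v z) = z \<bullet> (?L *v x)" for x z
      by (simp add: form mult.commute)
    show "subspace W"
      unfolding W_def by (rule subspace_hyperplane)
    show "(*v) ?L ` W \<subseteq> W"
      by (auto simp: W_def form)
    show "\<not> W \<subseteq> {0}"
      using False y0 by (auto simp: sum_W)
  qed blast
  have psd: "0 \<le> x \<bullet> (?L *v x)" for x
    by (auto simp: form intro!: sum_nonneg)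
  have "\<mu> > 0"
  proof (rule ccontr)
    assume "\<not> \<mu> > 0"
    then have "v \<bullet> (?L *v v) \<le> 0"
      unfolding v(3) by (simp add: mult_nonpos_nonneg)
    then have "v \<bullet> (?L *v v) = 0"
      using psd[of v] by linarith
    then have "(\<Sum>e\<in>E. (v $ fst e - v $ snd e)\<^sup>2) = 0"
      by (simp add: form case_prod_unfold power2_eq_square)
    then have "v $ i = v $ j" if "(i, j) \<in> E" for i j
      using that by (subst (asm) sum_nonneg_eq_0_iff) auto
    then have const: "v $ i = v $ j" for i j
      by (rule connected_graph_zero_differences_const[OF conn])
    have "v $ i = 0" for i
    proof -
      have "(\<Sum>j\<in>UNIV. v $ j) = (\<Sum>j\<in>(UNIV::'n set). v $ i)"
        by (intro sum.cong refl const)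
      with v(1) show ?thesis
        by (simp add: sum_W)
    qed
    with v(2) show False
      by (simp add: vec_eq_iff)
  qed
  \<comment> \<open>A zero polynomial would have an empty multiset of roots. A positive semidefinite matrix has no
    eigenvalue \<open>- 1\<close>, so the characteristic polynomial is not zero.\<close>
  have no_root: "poly (charpoly ?L) (- 1) \<noteq> 0"
  proof
    assume "poly (charpoly ?L) (- 1) = 0"
    then obtain w where w: "w \<noteq> 0" "?L *v w = (- 1) *s w"
      unfolding charpoly_root_iff_eigenvalue by blast
    then have "w \<bullet> w \<le> 0"
      using psd[of w] by (simp add: scalar_mult_eq_scaleR)
    with w(1) show False
      using inner_gt_zero_iff[of w] by linarith
  qed
  then have nz: "charpoly ?L \<noteq> 0"
    by auto
  have "?L *v 1 = 0 *s 1"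
    using form[of "?L *v 1" 1] by simp
  moreover have "(1 :: real ^ 'n) \<noteq> 0"
    by simp
  ultimately have "poly (charpoly ?L) 0 = 0"
    unfolding charpoly_root_iff_eigenvalue by blast
  moreover have "poly (charpoly ?L) \<mu> = 0"
    unfolding charpoly_root_iff_eigenvalue using v by (auto simp: scalar_mult_eq_scaleR)
  ultimately have "0 \<in> set (eigenvalues ?L)" "\<mu> \<in> set (eigenvalues ?L)"
    using nz by (simp_all add: eigenvalues_def)
  then have "algebraic_connectivity E \<le> \<mu>"
    unfolding algebraic_connectivity_def using \<open>\<mu> > 0\<close>
    by (intro second_le_if_less_mem[where a = 0]) (auto simp: eigenvalues_def)
  then have "algebraic_connectivity E * (norm y)\<^sup>2 \<le> \<mu> * (norm y)\<^sup>2"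
    by (intro mult_right_mono) auto
  also have "\<dots> \<le> y \<bullet> (?L *v y)"
    using rayleigh y0 by (simp add: sum_W)
  finally show ?thesis
    by (simp add: form power2_eq_square)
qed (simp add: sum_nonneg)

section \<open>One gossip step\<close>

lemma gossip_step_eq:
  "i \<noteq> j \<Longrightarrow> gossip_step s (i, j) x =
    x + (if x $ i < x $ j then s else - s) *\<^sub>R (axis i 1 - axis j 1)"
  by (auto simp: gossip_step_def vec_eq_iff axis_def)

lemma mean_gossip_step:
  assumes "i \<noteq> j"
  shows "mean (gossip_step s (i, j) x) = mean x"
proof -
  have "(\<Sum>l\<in>UNIV. (axis i 1 - axis j 1 :: real ^ 'a) $ l) = 0"
    by (simp add: sum_subtractf axis_def)
  then show ?thesis
    using assms by (simp add: mean_def gossip_step_eq sum.distrib sum_distrib_left[symmetric]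
        del: vector_minus_component)
qed

text \<open>
  Each endpoint moves towards the value of the other, so the cross term is
  \<open>- 2 * s * \<bar>x $ i - x $ j\<bar>\<close> in both cases of the comparison (and zero in a tie); moving two
  coordinates costs \<open>2 * s\<^sup>2\<close>.
\<close>

lemma norm_diff_const_gossip_step:
  assumes "i \<noteq> j"
  shows "(norm (a *\<^sub>R 1 - gossip_step s (i, j) x))\<^sup>2 =
    (norm (a *\<^sub>R 1 - x))\<^sup>2 + 2 * s\<^sup>2 - 2 * s * \<bar>x $ i - x $ j\<bar>"
proof -
  define r where "r = (if x $ i < x $ j then s else - s)"
  define d :: "real ^ 'a" where "d = axis i 1 - axis j 1"
  have zd: "z \<bullet> d = z $ i - z $ j" for z
    by (simp add: d_def inner_diff inner_axis)
  then have dd: "d \<bullet> d = 2"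
    using assms by (simp add: d_def axis_def)
  have "a *\<^sub>R 1 - gossip_step s (i, j) x = (a *\<^sub>R 1 - x) - r *\<^sub>R d"
    using gossip_step_eq[OF assms] by (simp add: r_def d_def)
  moreover have "(norm (z - r *\<^sub>R d))\<^sup>2 = (norm z)\<^sup>2 - 2 * r * (z \<bullet> d) + r\<^sup>2 * (d \<bullet> d)" for z
    unfolding power2_norm_eq_inner
    by (simp add: inner_commute algebra_simps power2_eq_square)
  ultimately have "(norm (a *\<^sub>R 1 - gossip_step s (i, j) x))\<^sup>2 =
      (norm (a *\<^sub>R 1 - x))\<^sup>2 - 2 * r * ((a *\<^sub>R 1 - x) \<bullet> d) + r\<^sup>2 * (d \<bullet> d)"
    by (simp only:)
  also have "\<dots> = (norm (a *\<^sub>R 1 - x))\<^sup>2 + 2 * s\<^sup>2 - 2 * s * \<bar>x $ i - x $ j\<bar>"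
    unfolding dd by (simp add: zd r_def algebra_simps)
  finally show ?thesis .
qed

definition gossip_rate :: "('n::finite \<times> 'n) set \<Rightarrow> real" where
  "gossip_rate E = 1 - algebraic_connectivity E / (2 * (real (card E))\<^sup>2)"

lemma sum_squares_le_square_sum_abs:
  fixes f :: "'a \<Rightarrow> real"
  assumes "finite A"
  shows "(\<Sum>a\<in>A. (f a)\<^sup>2) \<le> (\<Sum>a\<in>A. \<bar>f a\<bar>)\<^sup>2"
proof -
  have "(\<Sum>a\<in>A. (f a)\<^sup>2) \<le> (\<Sum>a\<in>A. \<bar>f a\<bar> * (\<Sum>b\<in>A. \<bar>f b\<bar>))"
  proof (rule sum_mono)
    fix a assume "a \<in> A"
    then have "\<bar>f a\<bar> \<le> (\<Sum>b\<in>A. \<bar>f b\<bar>)"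
      using assms by (intro member_le_sum) auto
    then have "\<bar>f a\<bar> * \<bar>f a\<bar> \<le> \<bar>f a\<bar> * (\<Sum>b\<in>A. \<bar>f b\<bar>)"
      by (intro mult_left_mono) auto
    then show "(f a)\<^sup>2 \<le> \<bar>f a\<bar> * (\<Sum>b\<in>A. \<bar>f b\<bar>)"
      by (simp add: power2_eq_square)
  qed
  also have "\<dots> = (\<Sum>a\<in>A. \<bar>f a\<bar>)\<^sup>2"
    by (simp add: power2_eq_square sum_distrib_right)
  finally show ?thesis .
qed

text \<open>
  With \<open>S\<close> the sum of the \<open>\<bar>x $ i - x $ j\<bar>\<close> over the edges, averaging the change of the squared
  distance over the edges gives \<open>2 * s\<^sup>2 - 2 * s * S / m\<close>, which is \<open>- S\<^sup>2 / (2 * m\<^sup>2)\<close> for the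
  adaptive step size. Finally \<open>S\<^sup>2\<close> dominates the sum of the squared differences, hence the
  algebraic connectivity times the squared distance.
\<close>

lemma average_gossip_step_le:
  fixes E :: "('n::finite \<times> 'n) set" and x :: "real ^ 'n"
  assumes conn: "connected_simple_graph E" and E: "E \<noteq> {}"
  shows "(\<Sum>e\<in>E. (norm (mean x *\<^sub>R 1 - gossip_step (adaptive_stepsize E x) e x))\<^sup>2) / real (card E)
    \<le> gossip_rate E * (norm (mean x *\<^sub>R 1 - x))\<^sup>2"
proof -
  define m where "m = real (card E)"
  define S where "S = (\<Sum>(i, j)\<in>E. \<bar>x $ i - x $ j\<bar>)"
  define s where "s = adaptive_stepsize E x"
  define y where "y = mean x *\<^sub>R 1 - x"
  have m: "m > 0"
    using E by (simp add: m_def card_gt_0_iff)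
  have s: "s = S / (2 * m)"
    by (simp add: s_def S_def m_def adaptive_stepsize_def)
  have loopfree: "i \<noteq> j" if "(i, j) \<in> E" for i j
    using conn that by (auto simp: connected_simple_graph_def dest: asymD)
  have "algebraic_connectivity E * (norm y)\<^sup>2 \<le> (\<Sum>(i, j)\<in>E. (y $ i - y $ j)\<^sup>2)"
    by (rule algebraic_connectivity_le_dirichlet[OF conn])
      (simp add: y_def sum_subtractf mean_def)
  also have "\<dots> = (\<Sum>e\<in>E. (x $ fst e - x $ snd e)\<^sup>2)"
    by (simp add: y_def case_prod_unfold power2_commute)
  also have "\<dots> \<le> S\<^sup>2"
    using sum_squares_le_square_sum_abs[of E "\<lambda>e. x $ fst e - x $ snd e"]
    by (simp add: S_def case_prod_unfold)
  finally have gap: "algebraic_connectivity E * (norm y)\<^sup>2 \<le> S\<^sup>2" .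
  have "(\<Sum>e\<in>E. (norm (mean x *\<^sub>R 1 - gossip_step s e x))\<^sup>2) =
      (\<Sum>(i, j)\<in>E. (norm y)\<^sup>2 + 2 * s\<^sup>2 - 2 * s * \<bar>x $ i - x $ j\<bar>)"
    by (intro sum.cong refl) (auto simp: norm_diff_const_gossip_step loopfree y_def)
  also have "\<dots> = m * ((norm y)\<^sup>2 + 2 * s\<^sup>2) - 2 * s * S"
    by (simp add: case_prod_unfold sum_subtractf sum_distrib_left m_def S_def)
  \<comment> \<open>The step size \<open>S / (2 * m)\<close> maximises the expected decrease \<open>2 * s * S / m - 2 * s\<^sup>2\<close>.\<close>
  also have "\<dots> = m * ((norm y)\<^sup>2 - S\<^sup>2 / (2 * m\<^sup>2))"
    using m by (simp add: s field_simps power2_eq_square)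
  finally have "(\<Sum>e\<in>E. (norm (mean x *\<^sub>R 1 - gossip_step s e x))\<^sup>2) / m =
      (norm y)\<^sup>2 - S\<^sup>2 / (2 * m\<^sup>2)"
    using m by simp
  also have "\<dots> \<le> (norm y)\<^sup>2 - algebraic_connectivity E * (norm y)\<^sup>2 / (2 * m\<^sup>2)"
    using gap m by (intro diff_left_mono divide_right_mono) auto
  also have "\<dots> = gossip_rate E * (norm y)\<^sup>2"
    by (simp add: gossip_rate_def m_def algebra_simps)
  finally show ?thesis
    by (simp add: m_def s_def y_def)
qed

lemma connected_simple_graph_nonempty:
  fixes E :: "('n::finite \<times> 'n) set"
  assumes "CARD('n) \<ge> 2" "connected_simple_graph E"
  shows "E \<noteq> {}"
proof
  assume "E = {}"
  then have "u = v" for u v :: 'n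
    using assms(2) by (auto simp: connected_simple_graph_def)
  then have "CARD('n) \<le> 1"
    by (simp add: card_le_Suc0_iff_eq)
  with assms(1) show False
    by simp
qed

text \<open>
  Iterating the contraction multiplies an inequality by the rate, which needs its sign. At a
  nonconstant vector, the averaged one-step bound puts an average of squares below the rate times a
  positive number.
\<close>

lemma gossip_rate_nonneg:
  fixes E :: "('n::finite \<times> 'n) set"
  assumes n: "CARD('n) \<ge> 2" and conn: "connected_simple_graph E"
  shows "gossip_rate E \<ge> 0"
proof -
  obtain i j where ij: "(i, j) \<in> E"
    using connected_simple_graph_nonempty[OF assms] by auto
  then have "i \<noteq> j"
    using conn by (auto simp: connected_simple_graph_def dest: asymD)
  define x :: "real ^ 'n" where "x = axis i 1 - axis j 1"
  have "x $ i = 1"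
    using \<open>i \<noteq> j\<close> by (simp add: x_def axis_def)
  moreover have "mean x = 0"
    by (simp add: x_def mean_def sum_subtractf axis_def)
  ultimately have "norm (mean x *\<^sub>R 1 - x) > 0"
    by auto
  moreover have "0 \<le> gossip_rate E * (norm (mean x *\<^sub>R 1 - x))\<^sup>2"
    by (rule order_trans[OF _ average_gossip_step_le[OF conn]])
      (use ij in \<open>auto intro!: divide_nonneg_nonneg sum_nonneg\<close>)
  ultimately show ?thesis
    by (simp add: zero_le_mult_iff)
qed

section \<open>Averaging over the random edges\<close>

lemma private_gossip_cong:
  "(\<And>s. s < t \<Longrightarrow> es s = es' s) \<Longrightarrow> private_gossip step c es t = private_gossip step c es' t"
  by (induction t) auto

text \<open>
  The mean is preserved only along genuine edges: at a loop \<open>(i, i)\<close> the definition of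
  \<open>gossip_step\<close> moves the single value \<open>x $ i\<close>.
\<close>

lemma mean_private_gossip:
  assumes "connected_simple_graph E" "\<And>s. es s \<in> E"
  shows "mean (private_gossip step c es t) = mean c"
proof (induction t)
  case (Suc t)
  obtain i j where ij: "es t = (i, j)"
    by fastforce
  then have "i \<noteq> j"
    using assms(1) assms(2)[of t] by (auto simp: connected_simple_graph_def dest: asymD)
  with Suc show ?case
    by (simp add: ij mean_gossip_step)
qed simp

context
  fixes M :: "'a measure" and E :: "('n::finite \<times> 'n) set" and \<xi> :: "nat \<Rightarrow> 'a \<Rightarrow> 'n \<times> 'n"
  assumes M: "prob_space M" and iid: "iid_uniform_edges M E \<xi>" and E: "E \<noteq> {}"
begin

interpretation prob_space M
  by (rule M)

lemma measurable_edge: "\<xi> t \<in> measurable M (count_space UNIV)"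
  using iid by (auto simp: iid_uniform_edges_def indep_vars_def)

lemma prob_edge: "prob {\<omega> \<in> space M. \<xi> t \<omega> = e} = indicator E e / real (card E)"
proof -
  have "prob {\<omega> \<in> space M. \<xi> t \<omega> = e} = measure (distr M (count_space UNIV) (\<xi> t)) {e}"
    by (subst measure_distr[OF measurable_edge]) (auto intro!: arg_cong[where f = prob])
  also have "\<dots> = pmf (pmf_of_set E) e"
    using iid by (simp add: iid_uniform_edges_def measure_pmf_single)
  finally show ?thesis
    using E by (simp add: pmf_of_set)
qed

lemma AE_edge: "AE \<omega> in M. \<forall>t. \<xi> t \<omega> \<in> E"
proof (rule AE_all_countable[THEN iffD2], intro allI)
  fix t
  have law: "distr M (count_space UNIV) (\<xi> t) = measure_pmf (pmf_of_set E)"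
    using iid by (simp add: iid_uniform_edges_def)
  have "AE e in distr M (count_space UNIV) (\<xi> t). e \<in> E"
    unfolding law using E by (simp add: AE_measure_pmf_iff)
  then show "AE \<omega> in M. \<xi> t \<omega> \<in> E"
    by (subst (asm) AE_distr_iff[OF measurable_edge]) auto
qed

lemma measurable_prefix:
  "(\<lambda>\<omega>. \<lambda>s\<in>{..<t}. \<xi> s \<omega>) \<in> measurable M (Pi\<^sub>M {..<t} (\<lambda>_. count_space UNIV))"
  by (intro measurable_restrict measurable_edge)

text \<open>
  There are only finitely many prefixes of a given length, so every function of a prefix is
  measurable and integrable.
\<close>

lemma prefix_function_measurable:
  fixes h :: "(nat \<Rightarrow> 'n \<times> 'n) \<Rightarrow> real"
  shows "h \<in> borel_measurable (Pi\<^sub>M {..<t} (\<lambda>_. count_space UNIV))"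
  by (subst count_space_PiM_finite) auto

lemma integrable_prefix_function:
  fixes h :: "(nat \<Rightarrow> 'n \<times> 'n) \<Rightarrow> real"
  shows "integrable M (\<lambda>\<omega>. h (\<lambda>s\<in>{..<t}. \<xi> s \<omega>))"
proof (rule integrable_const_bound)
  let ?P = "PiE {..<t} (\<lambda>_. UNIV :: ('n \<times> 'n) set)"
  have fin: "finite ?P"
    by (intro finite_PiE) auto
  show "AE \<omega> in M. norm (h (\<lambda>s\<in>{..<t}. \<xi> s \<omega>)) \<le> Max ((\<lambda>p. norm (h p)) ` ?P)"
    using fin by (intro AE_I2 Max_ge) auto
  show "(\<lambda>\<omega>. h (\<lambda>s\<in>{..<t}. \<xi> s \<omega>)) \<in> borel_measurable M"
    by (rule measurable_compose[OF measurable_prefix prefix_function_measurable])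
qed

text \<open>
  The edge \<open>\<xi> t\<close> is independent of the earlier ones, so it can be averaged out with the prefix held
  fixed. Splitting according to the value \<open>e\<close> of \<open>\<xi> t\<close> reduces this to the product rule for the
  expectation of the independent variables \<open>h e\<close> (of the prefix) and the indicator of
  \<open>\<xi> t = e\<close>; this replaces conditional expectations.
\<close>

lemma expectation_fresh_edge:
  fixes h :: "'n \<times> 'n \<Rightarrow> (nat \<Rightarrow> 'n \<times> 'n) \<Rightarrow> real"
  shows "expectation (\<lambda>\<omega>. h (\<xi> t \<omega>) (\<lambda>s\<in>{..<t}. \<xi> s \<omega>)) =
    expectation (\<lambda>\<omega>. (\<Sum>e\<in>E. h e (\<lambda>s\<in>{..<t}. \<xi> s \<omega>)) / real (card E))"
proof -
  let ?p = "\<lambda>\<omega>. \<lambda>s\<in>{..<t}. \<xi> s \<omega>"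
  let ?I = "\<lambda>e \<omega>. indicator {e} (\<xi> t \<omega>) :: real"
  have indep: "indep_var borel (\<lambda>\<omega>. h e (?p \<omega>)) borel (?I e)" for e
  proof -
    have "indep_var (Pi\<^sub>M {..<t} (\<lambda>_. count_space UNIV)) ?p
        (Pi\<^sub>M {t} (\<lambda>_. count_space UNIV)) (\<lambda>\<omega>. \<lambda>s\<in>{t}. \<xi> s \<omega>)"
      using iid by (intro indep_var_restrict[where I = UNIV]) (auto simp: iid_uniform_edges_def)
    then have "indep_var borel (h e \<circ> ?p) borel ((\<lambda>q. indicator {e} (q t)) \<circ> (\<lambda>\<omega>. \<lambda>s\<in>{t}. \<xi> s \<omega>))"
      by (rule indep_var_compose[OF _ prefix_function_measurable]) measurable
    then show ?thesis
      by (simp add: comp_def)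
  qed
  have int_I: "integrable M (?I e)" for e
    by (rule integrable_const_bound[where B = 1])
      (auto intro!: measurable_compose[OF measurable_edge])
  have exp_I: "expectation (?I e) = indicator E e / real (card E)" for e
  proof -
    have "expectation (?I e) = expectation (indicator {\<omega> \<in> space M. \<xi> t \<omega> = e})"
      by (rule Bochner_Integration.integral_cong) (auto simp: indicator_def)
    also have "\<dots> = prob {\<omega> \<in> space M. \<xi> t \<omega> = e}"
      by (auto intro!: arg_cong[where f = prob])
    finally show ?thesis
      by (simp add: prob_edge)
  qed
  have "expectation (\<lambda>\<omega>. h (\<xi> t \<omega>) (?p \<omega>)) = expectation (\<lambda>\<omega>. \<Sum>e\<in>UNIV. h e (?p \<omega>) * ?I e \<omega>)"
    by (simp add: indicator_def if_distrib cong: if_cong)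
  also have "\<dots> = (\<Sum>e\<in>UNIV. expectation (\<lambda>\<omega>. h e (?p \<omega>)) * expectation (?I e))"
    using indep_var_integrable[OF indep integrable_prefix_function int_I]
      indep_var_lebesgue_integral[OF indep integrable_prefix_function int_I]
    by (simp only: Bochner_Integration.integral_sum)
  also have "\<dots> = (\<Sum>e\<in>E. expectation (\<lambda>\<omega>. h e (?p \<omega>)) / real (card E))"
    unfolding exp_I by (rule sum.mono_neutral_cong_right) auto
  also have "\<dots> = expectation (\<lambda>\<omega>. (\<Sum>e\<in>E. h e (?p \<omega>)) / real (card E))"
    using integrable_prefix_function
    by (simp add: Bochner_Integration.integral_sum sum_divide_distrib)
  finally show ?thesis .
qed

end

section \<open>Geometric convergence in mean square\<close>

theorem theorem7:
  fixes E :: "('n::finite \<times> 'n) set"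
    and c :: "real ^ 'n"
    and M :: "'a measure"
    and \<xi> :: "nat \<Rightarrow> 'a \<Rightarrow> 'n \<times> 'n"
    and k :: nat
  assumes "CARD('n) \<ge> 2"
    and "connected_simple_graph E"
    and "prob_space M"
    and "iid_uniform_edges M E \<xi>"
  shows "prob_space.expectation M (\<lambda>\<omega>.
      (norm (mean c *\<^sub>R 1 - private_gossip (\<lambda>_. adaptive_stepsize E) c (\<lambda>t. \<xi> t \<omega>) k))\<^sup>2)
    \<le> (1 - algebraic_connectivity E / (2 * (real (card E))\<^sup>2)) ^ k
        * (norm (mean c *\<^sub>R 1 - c))\<^sup>2"
proof -
  interpret prob_space M
    by (rule assms(3))
  have E: "E \<noteq> {}"
    using connected_simple_graph_nonempty assms(1,2) by auto
  let ?x = "\<lambda>t es. private_gossip (\<lambda>_. adaptive_stepsize E) c es t"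
  let ?V = "\<lambda>x. (norm (mean c *\<^sub>R 1 - x))\<^sup>2"
  let ?p = "\<lambda>t \<omega>. \<lambda>s\<in>{..<t}. \<xi> s \<omega>"
  have prefix: "?x t (\<lambda>s. \<xi> s \<omega>) = ?x t (?p t \<omega>)" for t \<omega>
    by (rule private_gossip_cong) simp
  note integrable = integrable_prefix_function[OF assms(3,4) E]
  have "expectation (\<lambda>\<omega>. ?V (?x k (\<lambda>s. \<xi> s \<omega>))) \<le> gossip_rate E ^ k * ?V c"
  proof (induction k)
    case 0
    show ?case
      by (simp add: prob_space)
  next
    case (Suc t)
    have "expectation (\<lambda>\<omega>. ?V (?x (Suc t) (\<lambda>s. \<xi> s \<omega>))) =
        expectation (\<lambda>\<omega>. (\<Sum>e\<in>E. ?V (gossip_step (adaptive_stepsize E (?x t (?p t \<omega>))) e (?x t (?p t \<omega>))))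
          / real (card E))"
      using expectation_fresh_edge[OF assms(3,4) E, where t = t
          and h = "\<lambda>e q. ?V (gossip_step (adaptive_stepsize E (?x t q)) e (?x t q))"]
      by (simp add: prefix)
    also have "\<dots> \<le> expectation (\<lambda>\<omega>. gossip_rate E * ?V (?x t (?p t \<omega>)))"
    proof (rule integral_mono_AE)
      show "AE \<omega> in M. (\<Sum>e\<in>E. ?V (gossip_step (adaptive_stepsize E (?x t (?p t \<omega>))) e (?x t (?p t \<omega>))))
          / real (card E) \<le> gossip_rate E * ?V (?x t (?p t \<omega>))"
        using AE_edge[OF assms(3,4) E]
      proof eventually_elim
        case (elim \<omega>)
        then have "mean (?x t (?p t \<omega>)) = mean c"
          unfolding prefix[symmetric] by (intro mean_private_gossip[OF assms(2)]) auto
        then show ?case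
          using average_gossip_step_le[OF assms(2) E, of "?x t (?p t \<omega>)"] by simp
      qed
    qed (rule integrable)+
    also have "\<dots> = gossip_rate E * expectation (\<lambda>\<omega>. ?V (?x t (\<lambda>s. \<xi> s \<omega>)))"
      by (simp add: prefix)
    also have "\<dots> \<le> gossip_rate E * (gossip_rate E ^ t * ?V c)"
      using Suc.IH gossip_rate_nonneg[OF assms(1,2)] by (rule mult_left_mono)
    finally show ?case
      by simp
  qed
  then show ?thesis
    by (simp add: gossip_rate_def)
qed

end
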